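(* Let $T$ be a rooted tree of size $s$ with a distinguished set of vertices $V_D$ and let $n\ge s$ be an integer. Let $v\in V\setminus V_D$. Then $$ d(T;n)=\binom{n}{h_v}\cdot d(T_v;h_v)\cdot d(T\setminus T_v;n-h_v)-d\big(T^{\downarrow v};n\big), $$ where, by convention, $d(\emptyset;k)=1$ for $k\ge 0$.
   Context: Rooted trees are finite and nonempty (except where the empty tree $\emptyset$ is mentioned). $T$ has vertex set $V$ of size $s$; $p(v)$ is the parent of a non-root vertex $v$. $T$ comes with a distinguished subset $V_D\subseteq V$, whose elements are called descent vertices; all other vertices are ascent vertices. For an integer $n\ge s$, $G(T;n)$ is the rooted tree with $n$ vertices obtained by adding a chain of $n-s$ vertices above the root of $T$ (if $n>s$, the root of $T$ becomes the child of the bottom vertex of the chain and the top of the chain is the root of $G(T;n)$); the added vertices are ascent vertices. A labeling of a rooted tree with $m$ vertices is a bijection $w$ from its vertices to $[m]=\{1,\dots,m\}$, and $\mathrm{Des}(w)$ is the set of non-root vertices $v$ with $w(v)>w(p(v))$. $D(T;n)$ is the set of labelings $w$ of $G(T;n)$ with $\mathrm{Des}(w)=V_D$, and $d(T;n)=|D(T;n)|$. $T_v$ is the subtree of $T$ rooted at $v$ (consisting of $v$ and all its descendants), $h_v$ is its number of vertices, and $T\setminus T_v$ is the tree obtained from $T$ by deleting $T_v$ (empty if $v$ is the root). For $v\in V\setminus V_D$, $T^{\downarrow v}$ is $T$ with $v$ changed from an ascent vertex to a descent vertex (i.e. with distinguished set $V_D\cup\{v\}$). All these trees inherit their distinguished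 descent vertices from the tree they are derived from, and $d$ of such a tree is computed with the inherited set. *)

theory Defs
  imports Complex_Main "HOL-Library.FuncSet"
begin

text \<open>
  A finite rooted tree is given by its vertex set and its parent map, the root being the vertex
  without a parent; \<open>dverts\<close> is the distinguished set of descent vertices. Only the values of
  \<open>parent\<close> on \<open>verts\<close> matter. The empty tree has \<open>verts = {}\<close>; it is not a \<open>rooted_tree\<close>.
\<close>

record 'a rtree =
  verts :: "'a set"
  parent :: "'a \<Rightarrow> 'a option"
  dverts :: "'a set"

definition child_rel :: "'a rtree \<Rightarrow> ('a \<times> 'a) set" where
  "child_rel T = {(u, x). u \<in> verts T \<and> x \<in> verts T \<and> parent T u = Some x}"

definition rooted_tree :: "'a rtree \<Rightarrow> bool" where
  "rooted_tree T \<longleftrightarrow>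
     finite (verts T) \<and> dverts T \<subseteq> verts T \<and>
     (\<exists>r \<in> verts T. parent T r = None \<and> (\<forall>u \<in> verts T. (u, r) \<in> (child_rel T)\<^sup>*))"

definition tree_size :: "'a rtree \<Rightarrow> nat" where
  "tree_size T = card (verts T)"

text \<open>
  \<open>chain_ext T n\<close> is \<open>G(T; n)\<close>. The added chain is \<open>Inr 0, Inr 1, \<dots>\<close> from bottom to top.
\<close>

definition chain_ext :: "'a rtree \<Rightarrow> nat \<Rightarrow> ('a + nat) rtree" where
  "chain_ext T n =
     (let k = n - tree_size T in
      \<lparr> verts = Inl ` verts T \<union> Inr ` {..<k},
        parent = (\<lambda>x. case x of
            Inl u \<Rightarrow> (case parent T u of
                Some y \<Rightarrow> Some (Inl y)
              | None \<Rightarrow> (if 0 < k then Some (Inr 0) else None))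
          | Inr i \<Rightarrow> (if Suc i < k then Some (Inr (Suc i)) else None)),
        dverts = Inl ` dverts T \<rparr>)"

text \<open>Labelings are extensional functions, so that each bijection is counted once.\<close>

definition labelings :: "'a rtree \<Rightarrow> ('a \<Rightarrow> nat) set" where
  "labelings T =
     {w \<in> extensional (verts T). bij_betw w (verts T) {1..tree_size T}}"

definition Des :: "'a rtree \<Rightarrow> ('a \<Rightarrow> nat) \<Rightarrow> 'a set" where
  "Des T w = {u \<in> verts T. \<exists>x. parent T u = Some x \<and> w u > w x}"

text \<open>
  The root of \<open>T\<close> may be a distinguished descent vertex. It lies in \<open>Des\<close> only if a chain is
  actually added above it, so in that case \<open>D T (tree_size T)\<close> is empty.
\<close>

definition D :: "'a rtree \<Rightarrow> nat \<Rightarrow> ('a + nat \<Rightarrow> nat) set" where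
  "D T n = {w \<in> labelings (chain_ext T n). Des (chain_ext T n) w = dverts (chain_ext T n)}"

definition d :: "'a rtree \<Rightarrow> nat \<Rightarrow> nat" where
  "d T n = (if verts T = {} then 1 else card (D T n))"

definition subtree :: "'a rtree \<Rightarrow> 'a \<Rightarrow> 'a rtree" where
  "subtree T v =
     (let S = {u \<in> verts T. (u, v) \<in> (child_rel T)\<^sup>*} in
      \<lparr> verts = S, parent = (parent T)(v := None), dverts = dverts T \<inter> S \<rparr>)"

definition delete_subtree :: "'a rtree \<Rightarrow> 'a \<Rightarrow> 'a rtree" where
  "delete_subtree T v =
     (let R = verts T - verts (subtree T v) in
      \<lparr> verts = R, parent = parent T, dverts = dverts T \<inter> R \<rparr>)"

definition make_descent :: "'a rtree \<Rightarrow> 'a \<Rightarrow> 'a rtree" where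
  "make_descent T v = T\<lparr>dverts := insert v (dverts T)\<rparr>"

definition hook :: "'a rtree \<Rightarrow> 'a \<Rightarrow> nat" where
  "hook T v = tree_size (subtree T v)"

end

theory Submission
  imports Defs "HOL-Library.Infinite_Set"
begin

text \<open>
  Let \<open>G = G(T; n)\<close> and let \<open>S\<close> be the vertex set of \<open>T\<^sub>v\<close>. Moving \<open>d (make_descent T v) n\<close> to the
  other side, the claim counts the labelings of \<open>G\<close> whose descents are the prescribed ones up to a
  free choice at \<open>v\<close> (\<open>card_labelings_free_at\<close>). Since the edge above \<open>v\<close> is the only edge between \<open>S\<close> and its complement,
  leaving it unconstrained decouples the two parts: such a labeling is an arbitrary choice of the
  set \<open>C\<close> of labels used on \<open>S\<close>, together with independent labelings of \<open>S\<close> by \<open>C\<close> and of the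
  complement by the other labels (\<open>bij_betw_cut_labelings\<close>). Descents depend only on the relative
  order of the labels, so the number of labelings by a set of labels depends only on the size of
  that set (\<open>card_des_labelings_eq\<close>); hence there are \<open>n choose h\<^sub>v\<close> times the product of the two
  counts (\<open>card_cut_labelings\<close>).

  The two parts are \<open>G(T\<^sub>v; h\<^sub>v)\<close> and \<open>G(T \<setminus> T\<^sub>v; n - h\<^sub>v)\<close>. If \<open>v\<close> is the root of \<open>T\<close>, the second
  part is the bare chain, which has exactly one increasing labeling (\<open>card_chain_labelings\<close>); this
  matches the convention for the empty tree. If moreover \<open>n\<close> is the size of \<open>T\<close>, then \<open>v\<close> has no
  parent in \<open>G\<close> and there is nothing to choose; correspondingly, no labeling has \<open>v\<close> as a descent.
\<close>

section \<open>Labelings with prescribed descents\<close>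

text \<open>
  Only edges with both ends in \<open>A\<close> are considered, so that one parent map serves for a tree and for
  both parts into which it is cut; labels come from an arbitrary set \<open>B\<close>, as each part
  receives some subset of the labels.
\<close>

definition descents :: "('a \<Rightarrow> 'a option) \<Rightarrow> 'a set \<Rightarrow> ('a \<Rightarrow> nat) \<Rightarrow> 'a set" where
  "descents par A w = {u \<in> A. \<exists>x \<in> A. par u = Some x \<and> w x < w u}"

definition des_labelings ::
    "('a \<Rightarrow> 'a option) \<Rightarrow> 'a set \<Rightarrow> 'a set \<Rightarrow> nat set \<Rightarrow> ('a \<Rightarrow> nat) set" where
  "des_labelings par A E B = {w \<in> extensional A. bij_betw w A B \<and> descents par A w = E}"

lemma finite_extensional_bij:
  assumes "finite A" "finite B"
  shows "finite {w \<in> extensional A. bij_betw w A B \<and> P w}"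
proof (rule finite_subset)
  show "{w \<in> extensional A. bij_betw w A B \<and> P w} \<subseteq> A \<rightarrow>\<^sub>E B"
    by (auto simp: PiE_def dest: bij_betwE)
qed (use assms in \<open>auto intro: finite_PiE\<close>)

lemma finite_des_labelings:
  "finite A \<Longrightarrow> finite B \<Longrightarrow> finite (des_labelings par A E B)"
  unfolding des_labelings_def by (rule finite_extensional_bij)

lemma descents_cong:
  assumes "\<And>u x. u \<in> A \<Longrightarrow> x \<in> A \<Longrightarrow> (w x < w u) = (w' x < w' u)"
  shows "descents par A w = descents par A w'"
  using assms unfolding descents_def by blast

lemma des_labelings_cong:
  assumes "\<And>u x. u \<in> A \<Longrightarrow> x \<in> A \<Longrightarrow> (par u = Some x) = (par' u = Some x)"
  shows "des_labelings par A E B = des_labelings par' A E B"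
proof -
  have "descents par A w = descents par' A w" for w
    using assms unfolding descents_def by blast
  then show ?thesis unfolding des_labelings_def by simp
qed

text \<open>
  Composing with the increasing enumeration of \<open>B\<close> does not change the relative order of labels.
\<close>

lemma card_des_labelings_standard:
  fixes B :: "nat set"
  assumes "finite B"
  shows "card (des_labelings par A E {..<card B}) = card (des_labelings par A E B)"
proof -
  let ?N = "{..<card B}"
  obtain g where g: "bij_betw g ?N B" and mono: "strict_mono_on ?N g"
    using ex_bij_betw_strict_mono_card[OF assms] by blast
  define g' where "g' = inv_into ?N g"
  have g': "bij_betw g' B ?N" unfolding g'_def by (rule bij_betw_inv_into[OF g])
  have gg': "g (g' b) = b" if "b \<in> B" for b
    unfolding g'_def using bij_betw_inv_into_right[OF g that] .
  have g'g: "g' (g i) = i" if "i \<in> ?N" for i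
    unfolding g'_def using bij_betw_inv_into_left[OF g that] .
  have g_less: "g i < g j \<longleftrightarrow> i < j" if "i \<in> ?N" "j \<in> ?N" for i j
    using strict_mono_on_less[OF mono that] .
  have g'_less: "g' b < g' c \<longleftrightarrow> b < c" if "b \<in> B" "c \<in> B" for b c
    using g_less[of "g' b" "g' c"] bij_betwE[OF g'] that gg' by auto
  have push: "restrict (f \<circ> w) A \<in> des_labelings par A E Y"
    if w: "w \<in> des_labelings par A E X" and f: "bij_betw f X Y"
      and less: "\<And>i j. i \<in> X \<Longrightarrow> j \<in> X \<Longrightarrow> f i < f j \<longleftrightarrow> i < j"
    for f w X Y
  proof -
    have wb: "bij_betw w A X" and wd: "descents par A w = E"
      using w unfolding des_labelings_def by auto
    have "bij_betw (restrict (f \<circ> w) A) A Y"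
      using bij_betw_trans[OF wb f] by (simp cong: bij_betw_cong)
    moreover have "descents par A (restrict (f \<circ> w) A) = descents par A w"
      by (rule descents_cong) (use less bij_betwE[OF wb] in auto)
    ultimately show ?thesis using wd unfolding des_labelings_def by auto
  qed
  have "bij_betw (\<lambda>w. restrict (g \<circ> w) A) (des_labelings par A E ?N) (des_labelings par A E B)"
  proof (rule bij_betw_byWitness[where f' = "\<lambda>w. restrict (g' \<circ> w) A"])
    show "\<forall>w \<in> des_labelings par A E ?N. restrict (g' \<circ> restrict (g \<circ> w) A) A = w"
    proof
      fix w assume "w \<in> des_labelings par A E ?N"
      then have "w \<in> extensional A" and "\<And>u. u \<in> A \<Longrightarrow> w u \<in> ?N"
        unfolding des_labelings_def by (auto dest: bij_betwE)
      then show "restrict (g' \<circ> restrict (g \<circ> w) A) A = w"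
        using g'g by (intro extensionalityI[of _ A]) auto
    qed
    show "\<forall>w \<in> des_labelings par A E B. restrict (g \<circ> restrict (g' \<circ> w) A) A = w"
    proof
      fix w assume "w \<in> des_labelings par A E B"
      then have "w \<in> extensional A" and "\<And>u. u \<in> A \<Longrightarrow> w u \<in> B"
        unfolding des_labelings_def by (auto dest: bij_betwE)
      then show "restrict (g \<circ> restrict (g' \<circ> w) A) A = w"
        using gg' by (intro extensionalityI[of _ A]) auto
    qed
    show "(\<lambda>w. restrict (g \<circ> w) A) ` des_labelings par A E ?N \<subseteq> des_labelings par A E B"
      using push[OF _ g g_less] by blast
    show "(\<lambda>w. restrict (g' \<circ> w) A) ` des_labelings par A E B \<subseteq> des_labelings par A E ?N"
      using push[OF _ g' g'_less] by blast
  qed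
  then show ?thesis by (rule bij_betw_same_card)
qed

lemma card_des_labelings_eq:
  assumes "finite B" "finite C" "card B = card C"
  shows "card (des_labelings par A E B) = card (des_labelings par A E C)"
  using card_des_labelings_standard[OF assms(1), of par A E]
    card_des_labelings_standard[OF assms(2), of par A E] assms(3) by simp

section \<open>Cutting the edge above a vertex\<close>

text \<open>
  Every edge other than the one above \<open>v\<close> stays inside \<open>S\<close> or inside its complement, so the
  descents other than \<open>v\<close> can be read off from the restrictions of \<open>w\<close> to the two parts.
\<close>

lemma descents_cut:
  assumes "S \<subseteq> X" "v \<in> S"
    and inner: "\<And>u x. u \<in> X \<Longrightarrow> x \<in> X \<Longrightarrow> par u = Some x \<Longrightarrow> u \<noteq> v \<Longrightarrow> u \<in> S \<longleftrightarrow> x \<in> S"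
    and outer: "\<And>x. par v = Some x \<Longrightarrow> x \<notin> S"
  shows "descents par S w = (descents par X w - {v}) \<inter> S"
    and "descents par (X - S) w = (descents par X w - {v}) - S"
  using assms unfolding descents_def by auto

lemma bij_betw_cut_labelings:
  assumes SX: "S \<subseteq> X" and vS: "v \<in> S"
    and inner: "\<And>u x. u \<in> X \<Longrightarrow> x \<in> X \<Longrightarrow> par u = Some x \<Longrightarrow> u \<noteq> v \<Longrightarrow> u \<in> S \<longleftrightarrow> x \<in> S"
    and outer: "\<And>x. par v = Some x \<Longrightarrow> x \<notin> S"
  shows "bij_betw (\<lambda>w. (w ` S, restrict w S, restrict w (X - S)))
    {w \<in> extensional X. bij_betw w X B \<and> descents par X w - {v} = E}
    (SIGMA C : {C. C \<subseteq> B \<and> card C = card S}.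
       des_labelings par S (E \<inter> S) C \<times> des_labelings par (X - S) (E - S) (B - C))"
    (is "bij_betw ?f ?L ?R")
proof (rule bij_betw_byWitness[where f' = "\<lambda>(C, a, b) x. if x \<in> S then a x else b x"])
  have cut: "descents par S w = (descents par X w - {v}) \<inter> S"
    "descents par (X - S) w = (descents par X w - {v}) - S" for w
    using descents_cut[where S = S and X = X and v = v and par = par and w = w]
      SX vS inner outer by blast+
  show "\<forall>w \<in> ?L. (\<lambda>(C, a, b) x. if x \<in> S then a x else b x) (?f w) = w"
    using SX by (auto simp: fun_eq_iff extensional_def)
  show "\<forall>t \<in> ?R. ?f ((\<lambda>(C, a, b) x. if x \<in> S then a x else b x) t) = t"
  proof
    fix t assume "t \<in> ?R"
    then obtain C a b where t: "t = (C, a, b)"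
      and a: "a \<in> des_labelings par S (E \<inter> S) C"
      and b: "b \<in> des_labelings par (X - S) (E - S) (B - C)"
      by auto
    let ?w = "\<lambda>x. if x \<in> S then a x else b x"
    have "a ` S = C" using a unfolding des_labelings_def bij_betw_def by simp
    then have "?w ` S = C" by simp
    moreover have "restrict ?w S = a"
      using a unfolding des_labelings_def by (auto simp: fun_eq_iff extensional_def)
    moreover have "restrict ?w (X - S) = b"
      using b unfolding des_labelings_def by (auto simp: fun_eq_iff extensional_def)
    ultimately have "?f ((\<lambda>(C, a, b) x. if x \<in> S then a x else b x) (C, a, b)) = (C, a, b)"
      by simp
    then show "?f ((\<lambda>(C, a, b) x. if x \<in> S then a x else b x) t) = t" by (simp only: t)
  qed
  show "?f ` ?L \<subseteq> ?R"
  proof (rule image_subsetI)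
    fix w assume w: "w \<in> ?L"
    then have bij: "bij_betw w X B" and des: "descents par X w - {v} = E" by auto
    have inj: "inj_on w X" and img: "w ` X = B" using bij by (auto simp: bij_betw_def)
    have S: "bij_betw (restrict w S) S (w ` S)"
      using inj SX by (simp add: bij_betw_def inj_on_subset)
    have "w ` (X - S) = B - w ` S"
      using inj_on_image_set_diff[OF inj _ SX, of X] img by simp
    then have R: "bij_betw (restrict w (X - S)) (X - S) (B - w ` S)"
      using inj by (simp add: bij_betw_def inj_on_diff)
    have "descents par S (restrict w S) = E \<inter> S"
      using descents_cong[where A = S and w = "restrict w S" and w' = w and par = par]
        cut(1)[where w = w] des by simp
    moreover have "descents par (X - S) (restrict w (X - S)) = E - S"
      using descents_cong[where A = "X - S" and w = "restrict w (X - S)" and w' = w and par = par]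
        cut(2)[where w = w] des by simp
    moreover have "card (w ` S) = card S" "w ` S \<subseteq> B"
      using inj SX img by (auto intro: card_image inj_on_subset)
    ultimately show "?f w \<in> ?R" using S R unfolding des_labelings_def by auto
  qed
  show "(\<lambda>(C, a, b) x. if x \<in> S then a x else b x) ` ?R \<subseteq> ?L"
  proof (rule image_subsetI, clarify, intro conjI)
    fix C a b
    assume C: "C \<subseteq> B"
      and a: "a \<in> des_labelings par S (E \<inter> S) C"
      and b: "b \<in> des_labelings par (X - S) (E - S) (B - C)"
    let ?w = "\<lambda>x. if x \<in> S then a x else b x"
    show "?w \<in> extensional X"
      using b SX unfolding des_labelings_def extensional_def by auto
    have "bij_betw ?w S C"
      using a unfolding des_labelings_def by (simp cong: bij_betw_cong)
    moreover have "bij_betw ?w (X - S) (B - C)"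
      using b unfolding des_labelings_def by (subst bij_betw_cong[of _ _ b]) auto
    ultimately have "bij_betw ?w (S \<union> (X - S)) (C \<union> (B - C))"
      by (rule bij_betw_combine) auto
    then show "bij_betw ?w X B" using SX C by (simp add: Un_absorb1)
    have "descents par S ?w = E \<inter> S"
      using descents_cong[where A = S and w = ?w and w' = a and par = par] a
      unfolding des_labelings_def by simp
    moreover have "descents par (X - S) ?w = E - S"
      using descents_cong[where A = "X - S" and w = ?w and w' = b and par = par] b
      unfolding des_labelings_def by simp
    ultimately show "descents par X ?w - {v} = E"
      using cut[where w = ?w] by blast
  qed
qed

lemma card_cut_labelings:
  assumes SX: "S \<subseteq> X" and vS: "v \<in> S" and fin: "finite X" and card: "card X = n"
    and inner: "\<And>u x. u \<in> X \<Longrightarrow> x \<in> X \<Longrightarrow> par u = Some x \<Longrightarrow> u \<noteq> v \<Longrightarrow> u \<in> S \<longleftrightarrow> x \<in> S"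
    and outer: "\<And>x. par v = Some x \<Longrightarrow> x \<notin> S"
  shows "card {w \<in> extensional X. bij_betw w X {1..n} \<and> descents par X w - {v} = E} =
    (n choose card S) * (card (des_labelings par S (E \<inter> S) {1..card S})
      * card (des_labelings par (X - S) (E - S) {1..n - card S}))"
    (is "card ?L = _ * ?c")
proof -
  let ?I = "{C. C \<subseteq> {1..n} \<and> card C = card S}"
  let ?F = "\<lambda>C. des_labelings par S (E \<inter> S) C \<times> des_labelings par (X - S) (E - S) ({1..n} - C)"
  have finS: "finite S" using SX fin by (rule finite_subset)
  have "card ?L = card (Sigma ?I ?F)"
    by (rule bij_betw_same_card[OF bij_betw_cut_labelings[OF SX vS inner outer]])
  also have "\<dots> = (\<Sum>C\<in>?I. card (?F C))"
  proof (rule card_SigmaI)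
    show "finite ?I" by (rule finite_subset[of _ "Pow {1..n}"]) auto
    show "\<forall>C\<in>?I. finite (?F C)"
      using finS fin by (auto intro!: finite_des_labelings dest: finite_subset)
  qed
  also have "\<dots> = (\<Sum>C\<in>?I. ?c)"
  proof (rule sum.cong[OF refl])
    fix C assume "C \<in> ?I"
    then have C: "C \<subseteq> {1..n}" "card C = card S" and finC: "finite C"
      by (auto dest: finite_subset)
    have "card (des_labelings par S (E \<inter> S) C) = card (des_labelings par S (E \<inter> S) {1..card S})"
      by (rule card_des_labelings_eq) (use finC C in auto)
    moreover have "card (des_labelings par (X - S) (E - S) ({1..n} - C)) =
        card (des_labelings par (X - S) (E - S) {1..n - card S})"
      by (rule card_des_labelings_eq) (use finC C in \<open>auto simp: card_Diff_subset\<close>)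
    ultimately show "card (?F C) = ?c" by (simp add: card_cartesian_product)
  qed
  also have "\<dots> = (n choose card S) * ?c"
    using n_subsets[of "{1..n}" "card S"] by simp
  finally show ?thesis .
qed

lemma card_labelings_free_at:
  assumes fin: "finite X" "finite B" and "v \<notin> E"
  shows "card {w \<in> extensional X. bij_betw w X B \<and> descents par X w - {v} = E} =
    card (des_labelings par X E B) + card (des_labelings par X (insert v E) B)"
proof -
  have "{w \<in> extensional X. bij_betw w X B \<and> descents par X w - {v} = E} =
      des_labelings par X E B \<union> des_labelings par X (insert v E) B"
    using \<open>v \<notin> E\<close> unfolding des_labelings_def by auto
  moreover have "des_labelings par X E B \<inter> des_labelings par X (insert v E) B = {}"
    using \<open>v \<notin> E\<close> unfolding des_labelings_def by auto
  ultimately show ?thesis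
    using card_Un_disjoint finite_des_labelings[OF fin] by metis
qed

section \<open>The bare chain\<close>

text \<open>
  A labeling without descents increases up the chain, so the label of \<open>Inr i\<close> is the number of
  labels that are at most it, namely those of \<open>Inr 0, \<dots>, Inr i\<close>.
\<close>

lemma card_chain_labelings:
  fixes par :: "'a + nat \<Rightarrow> ('a + nat) option"
  assumes par: "\<And>i. par (Inr i) = (if Suc i < k then Some (Inr (Suc i)) else None)"
  shows "card (des_labelings par (Inr ` {..<k}) {} {1..k}) = 1"
proof -
  let ?A = "Inr ` {..<k} :: ('a + nat) set"
  define w0 :: "'a + nat \<Rightarrow> nat" where "w0 = restrict (case_sum (\<lambda>_. 0) Suc) ?A"
  have w0: "w0 \<in> des_labelings par ?A {} {1..k}"
  proof -
    have "bij_betw w0 ?A {1..k}"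
    proof (rule bij_betwI[where g = "\<lambda>m. Inr (m - 1)"])
      show "w0 \<in> ?A \<rightarrow> {1..k}" by (auto simp: w0_def)
      show "(\<lambda>m. Inr (m - 1)) \<in> {1..k} \<rightarrow> ?A" by auto
      show "Inr (w0 x - 1) = x" if "x \<in> ?A" for x using that by (auto simp: w0_def)
      show "w0 (Inr (m - 1)) = m" if "m \<in> {1..k}" for m
        using that by (auto simp: w0_def)
    qed
    moreover have "descents par ?A w0 = {}"
      by (auto simp: descents_def w0_def par split: if_splits)
    moreover have "w0 \<in> extensional ?A" by (simp add: w0_def)
    ultimately show ?thesis by (simp add: des_labelings_def)
  qed
  have "w = w0" if w: "w \<in> des_labelings par ?A {} {1..k}" for w
  proof -
    have ext: "w \<in> extensional ?A" and bij: "bij_betw w ?A {1..k}"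
      and des: "descents par ?A w = {}"
      using w unfolding des_labelings_def by auto
    have inj: "inj_on w ?A" and img: "w ` ?A = {1..k}" using bij by (auto simp: bij_betw_def)
    have step: "w (Inr i) < w (Inr (Suc i))" if "Suc i < k" for i
    proof -
      have "Inr i \<notin> descents par ?A w" by (simp add: des)
      then have "\<not> w (Inr (Suc i)) < w (Inr i)" using that by (auto simp: descents_def par)
      moreover have "w (Inr (Suc i)) \<noteq> w (Inr i)"
        using inj_onD[OF inj, of "Inr (Suc i)" "Inr i"] that by auto
      ultimately show ?thesis by simp
    qed
    have mono: "w (Inr i) < w (Inr j)" if "i < j" "j < k" for i j
      using that
    proof (induction j)
      case (Suc j)
      then show ?case using step[of j] by (cases "i = j") auto
    qed simp
    have val: "w (Inr i) = Suc i" if "i < k" for i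
    proof -
      have iff: "w (Inr j) \<le> w (Inr i) \<longleftrightarrow> j \<le> i" if "j < k" for j
        using mono[of i j] mono[of j i] that \<open>i < k\<close> by (cases j i rule: linorder_cases) auto
      have "w (Inr i) \<in> {1..k}" using img that by blast
      then have "{1..w (Inr i)} = {m \<in> w ` ?A. m \<le> w (Inr i)}"
        unfolding img by auto
      also have "\<dots> = w ` Inr ` {..i}"
        using iff that by (auto simp: image_iff)
      finally have "w (Inr i) = card (w ` Inr ` {..i})" by (metis card_atLeastAtMost diff_Suc_1)
      also have "\<dots> = card (Inr ` {..i} :: ('a + nat) set)"
        by (rule card_image, rule inj_on_subset[OF inj]) (use that in auto)
      finally show ?thesis by (simp add: card_image)
    qed
    show "w = w0"
      by (rule extensionalityI[OF ext]) (auto simp: w0_def val)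
  qed
  with w0 have "des_labelings par ?A {} {1..k} = {w0}" by blast
  then show ?thesis by simp
qed

section \<open>Extended trees\<close>

lemma parent_in_verts:
  assumes "rooted_tree T" "u \<in> verts T" "parent T u = Some x"
  shows "x \<in> verts T"
proof -
  obtain r where r: "parent T r = None" "(u, r) \<in> (child_rel T)\<^sup>*"
    using assms unfolding rooted_tree_def by blast
  have "u \<noteq> r" using r(1) assms(3) by auto
  then obtain y where "(u, y) \<in> child_rel T"
    using r(2) by (meson converse_rtranclE)
  then show ?thesis using assms(3) by (auto simp: child_rel_def)
qed

lemma verts_subtree: "verts (subtree T v) = {u \<in> verts T. (u, v) \<in> (child_rel T)\<^sup>*}"
  by (simp add: subtree_def Let_def)

lemma parent_in_subtree_iff:
  assumes T: "rooted_tree T" and u: "u \<in> verts T" "parent T u = Some x" "u \<noteq> v"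
  shows "u \<in> verts (subtree T v) \<longleftrightarrow> x \<in> verts (subtree T v)"
proof -
  have x: "x \<in> verts T" using parent_in_verts[OF T u(1,2)] .
  then have ux: "(u, x) \<in> child_rel T" using u by (simp add: child_rel_def)
  have "(u, v) \<in> (child_rel T)\<^sup>* \<longleftrightarrow> (x, v) \<in> (child_rel T)\<^sup>*"
  proof
    assume "(u, v) \<in> (child_rel T)\<^sup>*"
    then obtain y where "(u, y) \<in> child_rel T" "(y, v) \<in> (child_rel T)\<^sup>*"
      using u(3) by (meson converse_rtranclE)
    then show "(x, v) \<in> (child_rel T)\<^sup>*" using u(2) by (auto simp: child_rel_def)
  qed (rule converse_rtrancl_into_rtrancl[OF ux])
  then show ?thesis using x u(1) by (simp add: verts_subtree)
qed

text \<open>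
  A parent of \<open>v\<close> below \<open>v\<close> would lie on a cycle through \<open>v\<close>; as each vertex has at most one parent,
  no path could leave that cycle, yet there is one from \<open>v\<close> to the root.
\<close>

lemma parent_not_in_subtree:
  assumes T: "rooted_tree T" and v: "v \<in> verts T" "parent T v = Some x"
  shows "x \<notin> verts (subtree T v)"
proof
  assume "x \<in> verts (subtree T v)"
  then have xv: "(x, v) \<in> (child_rel T)\<^sup>*" by (simp add: verts_subtree)
  obtain r where r: "parent T r = None" "(v, r) \<in> (child_rel T)\<^sup>*"
    using T v unfolding rooted_tree_def by blast
  have "(r, v) \<in> (child_rel T)\<^sup>*"
    using r(2)
  proof (induction rule: rtrancl_induct)
    case (step y z)
    have "z = x" if "y = v" using step.hyps(2) v(2) that by (simp add: child_rel_def)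
    moreover have "(z, v) \<in> (child_rel T)\<^sup>*" if ne: "y \<noteq> v"
    proof -
      obtain z' where "(y, z') \<in> child_rel T" "(z', v) \<in> (child_rel T)\<^sup>*"
        using step.IH ne by (meson converse_rtranclE)
      then show ?thesis using step.hyps(2) by (auto simp: child_rel_def)
    qed
    ultimately show ?case using xv by auto
  qed simp
  then have "r = v" using r(1) by (auto elim: converse_rtranclE simp: child_rel_def)
  then show False using r(1) v(2) by simp
qed

lemma chain_ext_simps:
  "verts (chain_ext T n) = Inl ` verts T \<union> Inr ` {..<n - tree_size T}"
  "dverts (chain_ext T n) = Inl ` dverts T"
  "parent (chain_ext T n) (Inl u) = (case parent T u of Some y \<Rightarrow> Some (Inl y)
     | None \<Rightarrow> if 0 < n - tree_size T then Some (Inr 0) else None)"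
  "parent (chain_ext T n) (Inr i) =
     (if Suc i < n - tree_size T then Some (Inr (Suc i)) else None)"
  by (simp_all add: chain_ext_def Let_def)

lemma card_verts_chain_ext:
  assumes "finite (verts T)" "tree_size T \<le> n"
  shows "card (verts (chain_ext T n)) = n"
  using assms unfolding chain_ext_simps
  by (subst card_Un_disjoint) (auto simp: card_image tree_size_def)

lemma d_eq_card_des_labelings:
  assumes fin: "finite (verts T)" and n: "tree_size T \<le> n" and ne: "verts T \<noteq> {}"
    and closed: "\<forall>u \<in> verts T. \<forall>x. parent T u = Some x \<longrightarrow> x \<in> verts T"
  shows "d T n = card (des_labelings (parent (chain_ext T n)) (verts (chain_ext T n))
    (Inl ` dverts T) {1..n})"
proof -
  let ?G = "chain_ext T n"
  have "x \<in> verts ?G" if "u \<in> verts ?G" "parent ?G u = Some x" for u x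
    using that closed by (auto simp: chain_ext_simps split: option.splits if_splits)
  then have "Des ?G w = descents (parent ?G) (verts ?G) w" for w
    unfolding Des_def descents_def by blast
  then have "D T n = des_labelings (parent ?G) (verts ?G) (Inl ` dverts T) {1..n}"
    using card_verts_chain_ext[OF fin n]
    by (simp add: D_def labelings_def des_labelings_def tree_size_def[of ?G] chain_ext_simps(2)
      conj_assoc)
  then show ?thesis using ne by (simp add: d_def)
qed

text \<open>
  No chain is added above a tree extended to its own size. Making \<open>v\<close> parentless, as in \<open>T\<^sub>v\<close>, or
  keeping its parent, as in \<open>G(T; n)\<close>, is the same for \<open>descents\<close> on \<open>T\<^sub>v\<close>, because the parent lies
  outside \<open>T\<^sub>v\<close>.
\<close>

lemma d_subtree_eq:
  assumes T: "rooted_tree T" and v: "v \<in> verts T"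
  shows "d (subtree T v) (hook T v) = card (des_labelings (parent (chain_ext T n))
    (Inl ` verts (subtree T v)) (Inl ` dverts T \<inter> Inl ` verts (subtree T v)) {1..hook T v})"
proof -
  let ?S = "verts (subtree T v)"
  have sub: "parent (subtree T v) = (parent T)(v := None)" "dverts (subtree T v) = dverts T \<inter> ?S"
    by (simp_all add: subtree_def Let_def)
  have "?S \<subseteq> verts T" by (auto simp: verts_subtree)
  then have fin: "finite ?S" using T by (auto simp: rooted_tree_def dest: finite_subset)
  have vS: "v \<in> ?S" using v by (simp add: verts_subtree)
  have closed: "x \<in> ?S" if "u \<in> ?S" "parent (subtree T v) u = Some x" for u x
  proof -
    have "u \<noteq> v" "parent T u = Some x" using that(2) by (auto simp: sub split: if_splits)
    then show ?thesis using parent_in_subtree_iff[OF T] that(1) \<open>?S \<subseteq> verts T\<close> by blast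
  qed
  have "d (subtree T v) (hook T v) = card (des_labelings
      (parent (chain_ext (subtree T v) (hook T v))) (Inl ` ?S) (Inl ` (dverts T \<inter> ?S)) {1..hook T v})"
  proof -
    have "\<forall>u \<in> ?S. \<forall>x. parent (subtree T v) u = Some x \<longrightarrow> x \<in> ?S" using closed by blast
    moreover have "verts (chain_ext (subtree T v) (hook T v)) = Inl ` ?S"
      by (simp add: chain_ext_simps hook_def)
    moreover have "?S \<noteq> {}" using vS by blast
    ultimately show ?thesis
      using d_eq_card_des_labelings[OF fin, of "hook T v"] by (simp add: hook_def sub(2))
  qed
  also have "des_labelings (parent (chain_ext (subtree T v) (hook T v))) (Inl ` ?S)
      (Inl ` (dverts T \<inter> ?S)) {1..hook T v} =
    des_labelings (parent (chain_ext T n)) (Inl ` ?S) (Inl ` (dverts T \<inter> ?S)) {1..hook T v}"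
    using parent_not_in_subtree[OF T v]
    by (intro des_labelings_cong)
      (auto simp: chain_ext_simps sub hook_def split: option.splits if_splits)
  also have "Inl ` (dverts T \<inter> ?S) = (Inl ` dverts T \<inter> Inl ` ?S :: ('a + nat) set)"
    by (rule image_Int) simp
  finally show ?thesis .
qed

text \<open>
  The chains above \<open>T\<close> and above \<open>T \<setminus> T\<^sub>v\<close> have the same length, so \<open>G(T \<setminus> T\<^sub>v; n - h\<^sub>v)\<close> is literally
  the part of \<open>G(T; n)\<close> outside \<open>T\<^sub>v\<close>.
\<close>

lemma d_delete_subtree_eq:
  assumes T: "rooted_tree T" and n: "tree_size T \<le> n" and v: "v \<in> verts T"
  shows "d (delete_subtree T v) (n - hook T v) = card (des_labelings (parent (chain_ext T n))
    (verts (chain_ext T n) - Inl ` verts (subtree T v))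
    (Inl ` dverts T - Inl ` verts (subtree T v)) {1..n - hook T v})"
proof -
  let ?S = "verts (subtree T v)" and ?G = "chain_ext T n"
  let ?R = "delete_subtree T v"
  have R: "verts ?R = verts T - ?S" "parent ?R = parent T" "dverts ?R = dverts T \<inter> (verts T - ?S)"
    by (simp_all add: delete_subtree_def Let_def)
  have ST: "?S \<subseteq> verts T" by (auto simp: verts_subtree)
  have vS: "v \<in> ?S" using v by (simp add: verts_subtree)
  have finT: "finite (verts T)" and DT: "dverts T \<subseteq> verts T"
    using T by (auto simp: rooted_tree_def)
  have finS: "finite ?S" using ST finT by (rule finite_subset)
  have size_R: "tree_size ?R = tree_size T - hook T v"
    using ST finS by (simp add: tree_size_def hook_def R card_Diff_subset)
  have hook_le: "hook T v \<le> tree_size T"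
    using ST finT by (simp add: tree_size_def hook_def card_mono)
  have len: "n - hook T v - tree_size ?R = n - tree_size T"
    using size_R hook_le n by simp
  have verts_eq: "verts ?G - Inl ` ?S = Inl ` verts ?R \<union> Inr ` {..<n - tree_size T}"
    by (auto simp: chain_ext_simps R)
  have dverts_eq: "Inl ` dverts T - Inl ` ?S = Inl ` dverts ?R"
    using DT by (auto simp: R)
  have finR: "finite (verts ?R)" using finT by (simp add: R)
  have size_le: "tree_size ?R \<le> n - hook T v" using size_R n by (simp add: diff_le_mono)
  show ?thesis
  proof (cases "verts ?R = {}")
    case True
    then have "dverts ?R = {}" using R by auto
    moreover have "tree_size T = hook T v" using True size_R hook_le by (simp add: tree_size_def)
    moreover have "d ?R (n - hook T v) = 1" using True by (simp add: d_def)
    ultimately show ?thesis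
      unfolding verts_eq dverts_eq
      using True card_chain_labelings[of "parent ?G" "n - tree_size T"]
      by (simp add: chain_ext_simps)
  next
    case False
    have closed: "\<forall>u \<in> verts ?R. \<forall>x. parent ?R u = Some x \<longrightarrow> x \<in> verts ?R"
    proof (intro ballI allI impI)
      fix u x assume that: "u \<in> verts ?R" "parent ?R u = Some x"
      have u: "u \<in> verts T" "u \<notin> ?S" "parent T u = Some x" using that R by auto
      then have "u \<noteq> v" using vS by auto
      then show "x \<in> verts ?R"
        using parent_in_subtree_iff[OF T u(1,3)] parent_in_verts[OF T u(1,3)] u(2) R by auto
    qed
    have "verts (chain_ext ?R (n - hook T v)) = Inl ` verts ?R \<union> Inr ` {..<n - tree_size T}"
      by (simp only: chain_ext_simps(1) len)
    then have "d ?R (n - hook T v) = card (des_labelings (parent (chain_ext ?R (n - hook T v)))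
        (Inl ` verts ?R \<union> Inr ` {..<n - tree_size T}) (Inl ` dverts ?R) {1..n - hook T v})"
      using d_eq_card_des_labelings[OF finR size_le False closed] by (simp only:)
    moreover have "parent (chain_ext ?R (n - hook T v)) = parent ?G"
    proof
      fix x show "parent (chain_ext ?R (n - hook T v)) x = parent ?G x"
        by (cases x) (simp_all only: chain_ext_simps len R(2))
    qed
    ultimately show ?thesis unfolding verts_eq dverts_eq by simp
  qed
qed

section \<open>The recurrence\<close>

theorem corollary2p3:
  fixes T :: "'a rtree" and n :: nat and v :: 'a
  assumes "rooted_tree T"
    and "n \<ge> tree_size T"
    and "v \<in> verts T - dverts T"
  shows "int (d T n) =
    int (n choose hook T v) * int (d (subtree T v) (hook T v))
      * int (d (delete_subtree T v) (n - hook T v))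
    - int (d (make_descent T v) n)"
proof -
  let ?G = "chain_ext T n" and ?S = "verts (subtree T v)"
  let ?X = "verts ?G" and ?E = "Inl ` dverts T :: ('a + nat) set"
  have v: "v \<in> verts T" "v \<notin> dverts T" using assms(3) by auto
  have finT: "finite (verts T)" and ne: "verts T \<noteq> {}"
    using assms(1) by (auto simp: rooted_tree_def)
  have ST: "?S \<subseteq> verts T" by (auto simp: verts_subtree)
  have vS: "v \<in> ?S" using v by (simp add: verts_subtree)
  have card_S: "card (Inl ` ?S :: ('a + nat) set) = hook T v"
    by (simp add: card_image hook_def tree_size_def)
  have inner: "u \<in> Inl ` ?S \<longleftrightarrow> x \<in> Inl ` ?S"
    if "u \<in> ?X" "x \<in> ?X" "parent ?G u = Some x" "u \<noteq> Inl v" for u x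
  proof (cases u)
    case (Inl a)
    then have a: "a \<in> verts T" "a \<noteq> v" using that by (auto simp: chain_ext_simps)
    show ?thesis
    proof (cases "parent T a")
      case None
      \<comment> \<open>Here \<open>a\<close> is the root of \<open>T\<close>, which lies in \<open>T\<^sub>v\<close> only if it is \<open>v\<close>.\<close>
      have "a \<notin> ?S"
      proof
        assume "a \<in> ?S"
        then have "(a, v) \<in> (child_rel T)\<^sup>*" by (simp add: verts_subtree)
        then show False using a(2) None by (auto elim: converse_rtranclE simp: child_rel_def)
      qed
      then show ?thesis using Inl None that(3) by (auto simp: chain_ext_simps split: if_splits)
    next
      case (Some b)
      then show ?thesis
        using Inl that(3) parent_in_subtree_iff[OF assms(1) a(1) Some a(2)]
        by (auto simp: chain_ext_simps)
    qed
  next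
    case (Inr i)
    then show ?thesis using that(3) by (auto simp: chain_ext_simps split: if_splits)
  qed
  have outer: "x \<notin> Inl ` ?S" if "parent ?G (Inl v) = Some x" for x
    using that parent_not_in_subtree[OF assms(1) v(1)]
    by (auto simp: chain_ext_simps split: option.splits if_splits)
  have finX: "finite ?X" using finT by (simp add: chain_ext_simps)
  have SX: "Inl ` ?S \<subseteq> ?X" using ST by (auto simp: chain_ext_simps)
  have "card {w \<in> extensional ?X. bij_betw w ?X {1..n} \<and>
      descents (parent ?G) ?X w - {Inl v} = ?E} =
    (n choose hook T v) * (d (subtree T v) (hook T v) * d (delete_subtree T v) (n - hook T v))"
    using card_cut_labelings[OF SX _ finX card_verts_chain_ext[OF finT assms(2)] inner outer] vS
    unfolding card_S d_subtree_eq[OF assms(1) v(1), of n]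
      d_delete_subtree_eq[OF assms(1,2) v(1)]
    by blast
  moreover have "card {w \<in> extensional ?X. bij_betw w ?X {1..n} \<and>
      descents (parent ?G) ?X w - {Inl v} = ?E} = d T n + d (make_descent T v) n"
  proof -
    have md: "verts (make_descent T v) = verts T" "parent (make_descent T v) = parent T"
      "tree_size (make_descent T v) = tree_size T"
      "dverts (make_descent T v) = insert v (dverts T)"
      by (simp_all add: make_descent_def tree_size_def)
    have G: "verts (chain_ext (make_descent T v) n) = ?X"
      "parent (chain_ext (make_descent T v) n) = parent ?G"
      by (simp_all add: chain_ext_def Let_def md)
    have closed: "\<forall>u \<in> verts T. \<forall>x. parent T u = Some x \<longrightarrow> x \<in> verts T"
      using parent_in_verts[OF assms(1)] by blast
    have "d T n = card (des_labelings (parent ?G) ?X ?E {1..n})"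
      using d_eq_card_des_labelings[OF finT assms(2) ne closed] .
    moreover have "d (make_descent T v) n =
        card (des_labelings (parent ?G) ?X (insert (Inl v) ?E) {1..n})"
      using d_eq_card_des_labelings[of "make_descent T v" n] finT assms(2) ne closed
      by (simp add: md G)
    ultimately show ?thesis
      using card_labelings_free_at[OF finX, of "{1..n}" "Inl v" ?E "parent ?G"] v(2) by auto
  qed
  ultimately have "d T n + d (make_descent T v) n =
    (n choose hook T v) * (d (subtree T v) (hook T v) * d (delete_subtree T v) (n - hook T v))"
    by simp
  then have "int (d T n + d (make_descent T v) n) =
    int ((n choose hook T v) * (d (subtree T v) (hook T v) * d (delete_subtree T v) (n - hook T v)))"
    by simp
  then show ?thesis by (simp add: algebra_simps)
qed

end
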